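(* In a $\mathcal{P}$-configuration $(I,\delta,\Lambda)$ the following are equivalent: (1) $(I,\delta,\Lambda)$ is $\Lambda$-minimal. (2) There exists a $\Lambda$-weak attractor in $I\setminus\Lambda$.
   Context: $\mathcal{P}$-configuration: let $I=[a,b]$ be a closed interval in $\mathbb{R}$, $c\in(a,b)$, and let $\delta_1,\delta_2:I\to I$ be two $C^2$ maps with $\delta_1'(t)+\delta_2'(t)=1$ and $\delta_i'(t)\ge 0$ for all $t\in I$, $i=1,2$, and $\delta_2(a)=a$, $\delta_2(b)=\delta_1(a)=c$, $\delta_1(b)=b$. The guiding sets are $\Lambda_i=\{t\in I:\delta_i'(t)=0\}$, $i=1,2$; $\Lambda$ denotes the pair $(\Lambda_1,\Lambda_2)$ and, when used as a set (as in $I\setminus\Lambda$), the union $\Lambda_1\cup\Lambda_2$. A $\Lambda$-proper orbit emanating from $t_1$ is a finite or infinite sequence $(t_1,t_2,\dots)$ in $I$ such that for every $j\ge 2$ there is an index $i$ with $t_{j-1}\notin\Lambda_i$ and $t_j=\delta_i(t_{j-1})$. $\Lambda\text{-}OS(t)$ is the set of all $s$ for which there is a finite $\Lambda$-proper orbit $(t,\dots,s)$ (the one-term orbit $(t)$ is allowed). The system is $\Lambda$-minimal if $\overline{\Lambda\text{-}OS(t)}=I$ for all $t\in I$. A point $t_0\in I$ is a $\Lambda$-weak attractor if $t_0\in\bigcap_{t\in I}\overline{\Lambda\text{-}OS(t)}$. *)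

theory Defs
  imports "HOL-Analysis.Analysis"
begin

text \<open>
  Derivatives are taken relative to the interval, hence one-sided at its endpoints, so that
  values of a map outside the interval never matter. The two maps are \<open>\<delta> 1\<close> and \<open>\<delta> 2\<close>;
  \<open>\<delta> i\<close> and \<open>\<Lambda> i\<close> for other indices are ignored.
\<close>

abbreviation deriv_within :: "real set \<Rightarrow> (real \<Rightarrow> real) \<Rightarrow> real \<Rightarrow> real" where
  "deriv_within S f t \<equiv> vector_derivative f (at t within S)"

definition C2_on :: "real set \<Rightarrow> (real \<Rightarrow> real) \<Rightarrow> bool" where
  "C2_on S f \<longleftrightarrow> (\<exists>f' f''. (\<forall>t\<in>S. (f has_real_derivative f' t) (at t within S)) \<and>
     (\<forall>t\<in>S. (f' has_real_derivative f'' t) (at t within S)) \<and> continuous_on S f'')"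

definition P_configuration :: "real \<Rightarrow> real \<Rightarrow> real \<Rightarrow> (nat \<Rightarrow> real \<Rightarrow> real) \<Rightarrow> bool" where
  "P_configuration a b c \<delta> \<longleftrightarrow>
     c \<in> {a<..<b} \<and>
     (\<forall>i\<in>{1, 2}. \<delta> i \<in> {a..b} \<rightarrow> {a..b} \<and> C2_on {a..b} (\<delta> i)) \<and>
     (\<forall>t\<in>{a..b}. deriv_within {a..b} (\<delta> 1) t + deriv_within {a..b} (\<delta> 2) t = 1) \<and>
     (\<forall>i\<in>{1, 2}. \<forall>t\<in>{a..b}. deriv_within {a..b} (\<delta> i) t \<ge> 0) \<and>
     \<delta> 2 a = a \<and> \<delta> 2 b = c \<and> \<delta> 1 a = c \<and> \<delta> 1 b = b"

definition guiding_set :: "real set \<Rightarrow> (nat \<Rightarrow> real \<Rightarrow> real) \<Rightarrow> nat \<Rightarrow> real set" where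
  "guiding_set I \<delta> i = {t \<in> I. deriv_within I (\<delta> i) t = 0}"

text \<open>
  Finite \<open>\<Lambda>\<close>-proper orbits are nonempty lists. Infinite orbits play no role in \<open>\<Lambda>\<close>-orbit sets.
\<close>

definition proper_orbit ::
  "real set \<Rightarrow> (nat \<Rightarrow> real \<Rightarrow> real) \<Rightarrow> (nat \<Rightarrow> real set) \<Rightarrow> real list \<Rightarrow> bool" where
  "proper_orbit I \<delta> \<Lambda> ts \<longleftrightarrow> ts \<noteq> [] \<and> set ts \<subseteq> I \<and>
     (\<forall>j. Suc j < length ts \<longrightarrow> (\<exists>i\<in>{1, 2}. ts ! j \<notin> \<Lambda> i \<and> ts ! Suc j = \<delta> i (ts ! j)))"

definition orbit_set ::
  "real set \<Rightarrow> (nat \<Rightarrow> real \<Rightarrow> real) \<Rightarrow> (nat \<Rightarrow> real set) \<Rightarrow> real \<Rightarrow> real set" where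
  "orbit_set I \<delta> \<Lambda> t = {s. \<exists>ts. proper_orbit I \<delta> \<Lambda> ts \<and> hd ts = t \<and> last ts = s}"

definition minimal_system ::
  "real set \<Rightarrow> (nat \<Rightarrow> real \<Rightarrow> real) \<Rightarrow> (nat \<Rightarrow> real set) \<Rightarrow> bool" where
  "minimal_system I \<delta> \<Lambda> \<longleftrightarrow> (\<forall>t\<in>I. closure (orbit_set I \<delta> \<Lambda> t) = I)"

definition weak_attractor ::
  "real set \<Rightarrow> (nat \<Rightarrow> real \<Rightarrow> real) \<Rightarrow> (nat \<Rightarrow> real set) \<Rightarrow> real \<Rightarrow> bool" where
  "weak_attractor I \<delta> \<Lambda> t0 \<longleftrightarrow> t0 \<in> I \<and> t0 \<in> (\<Inter>t\<in>I. closure (orbit_set I \<delta> \<Lambda> t))"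

end

theory Submission
  imports Defs
begin

text \<open>
  Integration gives \<open>\<delta> 1 t + \<delta> 2 t = t + c\<close>, so the two images of an interval have total length equal
  to that of the interval, and, the ranges of the two maps meeting only in \<open>c\<close>, proper orbits
  are determined backwards except at \<open>c\<close>. Let \<open>K\<close> be the orbit closure of a weak attractor \<open>t\<close>
  outside \<open>\<Lambda>\<close>. Then \<open>K\<close> lies in every orbit closure, is mapped into itself by proper steps, and is
  covered by its two images. If \<open>t\<close> were isolated in \<open>K\<close>, two different cycles would pass through
  it, against backward determinism. If \<open>K\<close> contains an interval, it is everything, since a proper
  orbit starting inside \<open>(a, b) - K\<close> never enters \<open>K\<close>. Otherwise there are arbitrarily short gaps of
  \<open>K\<close> with endpoints near \<open>t\<close>. A gap whose endpoints both avoid \<open>\<Lambda> i\<close> is mapped by \<open>\<delta> i\<close> onto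
  a gap, and if an endpoint is in \<open>\<Lambda> i\<close>, then by \<open>C\<^sup>2\<close>-smoothness the image is only quadratically long.
  Hence the tree of gaps descending from a short gap loses at most half of its length in all
  generations together; as its generations are disjoint, their total length would be infinite.
\<close>

section \<open>Gaps of a bounded set and their total length\<close>

definition gaps :: "real set \<Rightarrow> (real \<times> real) set" where
  "gaps K = {(p, q). p \<in> K \<and> q \<in> K \<and> p < q \<and> {p<..<q} \<inter> K = {}}"

abbreviation len :: "real \<times> real \<Rightarrow> real" where
  "len g \<equiv> snd g - fst g"

lemma gapsD:
  assumes "g \<in> gaps K"
  shows "fst g \<in> K" "snd g \<in> K" "fst g < snd g" "{fst g<..<snd g} \<inter> K = {}"
  using assms by (auto simp: gaps_def)

lemma disjoint_gaps: "disjoint_family_on (\<lambda>g. {fst g<..<snd g}) (gaps K)"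
proof (unfold disjoint_family_on_def, intro ballI impI)
  fix g h assume gh: "g \<in> gaps K" "h \<in> gaps K" "g \<noteq> h"
  show "{fst g<..<snd g} \<inter> {fst h<..<snd h} = {}"
  proof (rule ccontr)
    assume "{fst g<..<snd g} \<inter> {fst h<..<snd h} \<noteq> {}"
    then obtain z where "z \<in> {fst g<..<snd g} \<inter> {fst h<..<snd h}" by blast
    then have z: "fst g < z" "z < snd g" "fst h < z" "z < snd h" by simp_all
    have "fst h \<notin> {fst g<..<snd g}" "fst g \<notin> {fst h<..<snd h}"
      "snd h \<notin> {fst g<..<snd g}" "snd g \<notin> {fst h<..<snd h}"
      using gapsD[OF gh(1)] gapsD[OF gh(2)] by blast+
    then have "fst g = fst h" "snd g = snd h" using z by auto
    then show False using gh(3) by (simp add: prod_eq_iff)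
  qed
qed

lemma sum_gaps_le:
  assumes "K \<subseteq> {a..b}" "a \<le> b" "finite F" "F \<subseteq> gaps K"
  shows "sum len F \<le> b - a"
proof -
  have "sum len F = (\<Sum>g\<in>F. measure lborel {fst g<..<snd g})"
    using assms gapsD(3) by (intro sum.cong) (auto simp: less_imp_le)
  also have "\<dots> = measure lborel (\<Union>g\<in>F. {fst g<..<snd g})"
    using assms(3) disjoint_family_on_mono[OF assms(4) disjoint_gaps] gapsD(3)[OF subsetD[OF assms(4)]]
    by (intro measure_finite_Union[symmetric]) (auto simp: less_imp_le)
  also have "\<dots> \<le> measure lborel {a..b}"
  proof (rule measure_mono_fmeasurable)
    show "(\<Union>g\<in>F. {fst g<..<snd g}) \<in> sets lborel"
      using assms(3) by (intro sets.finite_UN) auto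
    show "{a..b} \<in> fmeasurable lborel"
      using fmeasurable_cbox[of a b] by (simp add: fmeasurable_def)
    have "{fst g<..<snd g} \<subseteq> {a..b}" if "g \<in> F" for g
      using gapsD(1,2)[of g K] that assms by force
    then show "(\<Union>g\<in>F. {fst g<..<snd g}) \<subseteq> {a..b}" by blast
  qed
  finally show ?thesis using assms by simp
qed

text \<open>This is the smallness of the tail of a convergent series: finite sums of gap lengths are
  bounded by \<open>b - a\<close>, so some finite family \<open>F0\<close> comes within \<eta> of
  their supremum, and gaps shorter than all of \<open>F0\<close> can add at most \<eta> to
  it.\<close>

lemma short_gaps_small_total:
  assumes "K \<subseteq> {a..b}" "a \<le> b" "0 < \<eta>"
  obtains \<epsilon> where "0 < \<epsilon>"
    "\<And>F. finite F \<Longrightarrow> F \<subseteq> gaps K \<Longrightarrow> (\<And>g. g \<in> F \<Longrightarrow> len g < \<epsilon>) \<Longrightarrow> sum len F \<le> \<eta>"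
proof -
  define S where "S = sum len ` {F. finite F \<and> F \<subseteq> gaps K}"
  have bdd: "bdd_above S"
    unfolding S_def bdd_above_def using sum_gaps_le[OF assms(1,2)] by blast
  have "S \<noteq> {}" unfolding S_def by blast
  then obtain s where "s \<in> S" "Sup S - \<eta> < s"
    using less_cSupD[of S "Sup S - \<eta>"] assms(3) by auto
  then obtain F0 where F0: "finite F0" "F0 \<subseteq> gaps K" "Sup S - \<eta> < sum len F0"
    unfolding S_def by blast
  \<comment> \<open>The inserted 1 gives \<open>Min\<close> a nonempty set even when
    \<open>F0\<close> is empty.\<close>
  define \<epsilon> where "\<epsilon> = Min (insert 1 (len ` F0))"
  have "0 < \<epsilon>"
    unfolding \<epsilon>_def using F0 gapsD(3) by (subst Min_gr_iff) auto
  moreover have "sum len F \<le> \<eta>"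
    if F: "finite F" "F \<subseteq> gaps K" "\<And>g. g \<in> F \<Longrightarrow> len g < \<epsilon>" for F
  proof -
    have "\<epsilon> \<le> len g" if "g \<in> F0" for g
      unfolding \<epsilon>_def using F0(1) that by (intro Min_le) auto
    then have "F \<inter> F0 = {}" using F(3) by force
    then have "sum len F + sum len F0 = sum len (F \<union> F0)"
      using F(1) F0(1) by (simp add: sum.union_disjoint)
    also have "\<dots> \<le> Sup S"
      using F F0 by (intro cSup_upper bdd) (auto simp: S_def)
    finally show ?thesis using F0(3) by linarith
  qed
  ultimately show thesis by (rule that)
qed

section \<open>Two monotone maps whose derivatives sum to 1\<close>

locale two_branches =
  fixes a b c B :: real and d d' :: "nat \<Rightarrow> real \<Rightarrow> real"
  assumes c_bounds: "a < c" "c < b"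
    and maps_to: "\<And>i t. i \<in> {1, 2} \<Longrightarrow> t \<in> {a..b} \<Longrightarrow> d i t \<in> {a..b}"
    and deriv: "\<And>i t. i \<in> {1, 2} \<Longrightarrow> t \<in> {a..b} \<Longrightarrow>
      (d i has_real_derivative d' i t) (at t within {a..b})"
    and lipschitz: "\<And>i s t. i \<in> {1, 2} \<Longrightarrow> s \<in> {a..b} \<Longrightarrow> t \<in> {a..b} \<Longrightarrow>
      \<bar>d' i s - d' i t\<bar> \<le> B * \<bar>s - t\<bar>"
    and deriv_sum: "\<And>t. t \<in> {a..b} \<Longrightarrow> d' 1 t + d' 2 t = 1"
    and deriv_nonneg: "\<And>i t. i \<in> {1, 2} \<Longrightarrow> t \<in> {a..b} \<Longrightarrow> 0 \<le> d' i t"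
    and endpoints: "d 2 a = a" "d 2 b = c" "d 1 a = c" "d 1 b = b"
begin

lemma mean_value:
  assumes "i \<in> {1, 2}" "a \<le> x" "x < y" "y \<le> b"
  obtains z where "x < z" "z < y" "d i y - d i x = d' i z * (y - x)"
proof -
  have "\<exists>z\<in>{x<..<y}. d i y - d i x = d' i z * (y - x)"
  proof (rule mvt_simple[OF \<open>x < y\<close>])
    fix z assume "x \<le> z" "z \<le> y"
    then have "(d i has_real_derivative d' i z) (at z within {x..y})"
      using assms by (intro has_field_derivative_subset[OF deriv]) auto
    then show "(d i has_derivative (*) (d' i z)) (at z within {x..y})"
      by (simp add: has_field_derivative_def)
  qed
  then show thesis using that by auto
qed

lemma B_nonneg: "0 \<le> B"
proof -
  have "0 \<le> B * \<bar>a - b\<bar>" using lipschitz[of 1 a b] c_bounds by force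
  then show ?thesis using c_bounds by (simp add: zero_le_mult_iff)
qed

lemma mono:
  assumes "i \<in> {1, 2}" "a \<le> x" "x \<le> y" "y \<le> b"
  shows "d i x \<le> d i y"
proof (cases "x = y")
  case False
  then obtain z where z: "x < z" "z < y" "d i y - d i x = d' i z * (y - x)"
    using mean_value[of i x y] assms by auto
  moreover have "0 \<le> d' i z * (y - x)"
    using z assms deriv_nonneg[of i z] by auto
  ultimately show ?thesis by linarith
qed simp

text \<open>The derivative of the sum is constantly 1 and its value at \<open>a\<close> is
  \<open>a + c\<close>.\<close>

lemma sum_eq:
  assumes "t \<in> {a..b}"
  shows "d 1 t + d 2 t = t + c"
proof (cases "t = a")
  case False
  have "\<exists>z\<in>{a<..<t}. (d 1 t + d 2 t) - (d 1 a + d 2 a) = 1 * (t - a)"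
  proof (rule mvt_simple[where f = "\<lambda>x. d 1 x + d 2 x" and f' = "\<lambda>_. (*) 1"])
    fix z assume z: "a \<le> z" "z \<le> t"
    then have "((\<lambda>x. d 1 x + d 2 x) has_real_derivative d' 1 z + d' 2 z) (at z within {a..t})"
      using assms by (intro DERIV_add has_field_derivative_subset[OF deriv]) auto
    then show "((\<lambda>x. d 1 x + d 2 x) has_derivative (*) 1) (at z within {a..t})"
      using z assms deriv_sum[of z] by (simp add: has_field_derivative_def)
  qed (use False assms in auto)
  then show ?thesis using endpoints by simp
qed (use endpoints in simp)

lemma range_1: "t \<in> {a..b} \<Longrightarrow> c \<le> d 1 t"
  using mono[of 1 a t] endpoints by simp

lemma range_2: "t \<in> {a..b} \<Longrightarrow> d 2 t \<le> c"
  using mono[of 2 t b] endpoints by simp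

text \<open>By monotonicity, equal values at two distinct points make \<open>d i\<close> constant
  between them, so its one-sided derivative at \<open>x\<close> would vanish. A nonzero derivative
  at one of the two points suffices.\<close>

lemma inj_at:
  assumes "i \<in> {1, 2}" "x \<in> {a..b}" "y \<in> {a..b}" "d' i x \<noteq> 0" "d i x = d i y"
  shows "x = y"
proof (rule ccontr)
  assume "x \<noteq> y"
  define l r where "l = min x y" and "r = max x y"
  have lr: "l < r" "a \<le> l" "r \<le> b" "x \<in> {l..r}" "d i l = d i r" "d i l = d i x"
    using \<open>x \<noteq> y\<close> assms by (auto simp: l_def r_def min_def max_def)
  have const: "d i z = d i x" if "z \<in> {l..r}" for z
    using that lr mono[of i l z] mono[of i z r] assms(1) by force
  have "((\<lambda>_. d i x) has_real_derivative 0) (at x within {l..r})" by simp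
  then have "(d i has_real_derivative 0) (at x within {l..r})"
    by (rule has_field_derivative_transform_within[where d = 1]) (use lr(4) in \<open>auto intro: const[symmetric]\<close>)
  moreover have "(d i has_real_derivative d' i x) (at x within {l..r})"
    using assms lr by (intro has_field_derivative_subset[OF deriv]) auto
  ultimately have "d' i x = 0"
    using vector_derivative_within_closed_interval[OF lr(1,4)]
    by (metis has_real_derivative_iff_has_vector_derivative)
  with assms show False by simp
qed

text \<open>The mean slope is attained at some \<open>z\<close> between \<open>p\<close> and
  \<open>q\<close>; since \<open>d' i\<close> vanishes at one endpoint, the Lipschitz bound makes
  this slope at most \<open>B * (q - p)\<close>.\<close>

lemma quadratic:
  assumes "i \<in> {1, 2}" "a \<le> p" "p \<le> q" "q \<le> b" "d' i p = 0 \<or> d' i q = 0"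
  shows "d i q - d i p \<le> B * (q - p)\<^sup>2"
proof (cases "p = q")
  case False
  then obtain z where z: "p < z" "z < q" "d i q - d i p = d' i z * (q - p)"
    using mean_value[of i p q] assms by auto
  obtain e where e: "e \<in> {p, q}" "d' i e = 0" using assms by auto
  have "d' i z \<le> B * \<bar>z - e\<bar>"
    using lipschitz[of i z e] assms z e by auto
  also have "\<dots> \<le> B * (q - p)"
    using B_nonneg z e by (intro mult_left_mono) auto
  finally have "d' i z * (q - p) \<le> B * (q - p) * (q - p)"
    using assms by (intro mult_right_mono) auto
  then show ?thesis using z by (simp add: power2_eq_square algebra_simps)
qed simp

section \<open>Proper steps and their uniqueness backwards\<close>

text \<open>Relational form of \<Lambda>-proper orbits: a nonzero \<open>d' i x\<close> says that
  \<open>x\<close> is outside the guiding set \<open>i\<close>, and orbit sets become reachability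
  under \<open>proper_step\<^sup>*\<^sup>*\<close>.\<close>

definition proper_step :: "real \<Rightarrow> real \<Rightarrow> bool" where
  "proper_step x y \<longleftrightarrow> x \<in> {a..b} \<and> (\<exists>i\<in>{1, 2}. d' i x \<noteq> 0 \<and> y = d i x)"

lemma proper_stepI:
  "i \<in> {1, 2} \<Longrightarrow> x \<in> {a..b} \<Longrightarrow> d' i x \<noteq> 0 \<Longrightarrow> proper_step x (d i x)"
  by (auto simp: proper_step_def)

lemma proper_stepE:
  assumes "proper_step x y"
  obtains i where "i \<in> {1, 2}" "x \<in> {a..b}" "d' i x \<noteq> 0" "d i x = y"
  using assms unfolding proper_step_def by blast

lemma steps_in: "proper_step\<^sup>*\<^sup>* x y \<Longrightarrow> x \<in> {a..b} \<Longrightarrow> y \<in> {a..b}"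
proof (induction rule: rtranclp_induct)
  case (step y z)
  then obtain i where "i \<in> {1, 2}" "y \<in> {a..b}" "z = d i y"
    unfolding proper_step_def by blast
  then show ?case using maps_to by blast
qed

text \<open>Different maps have ranges on opposite sides of \<open>c\<close>, so a common value is
  \<open>c\<close>, and injectivity at \<open>x\<close> then puts \<open>x\<close> at the endpoint
  sent there. Only the step from \<open>x\<close> has to be proper; \<open>x'\<close> may be any
  preimage.\<close>

lemma same_image_cases:
  assumes "i \<in> {1, 2}" "x \<in> {a..b}" "d' i x \<noteq> 0" "k \<in> {1, 2}" "x' \<in> {a..b}" "d i x = d k x'"
  shows "x = x' \<and> i = k \<or> d i x = c \<and> (i = 1 \<and> x = a \<or> i = 2 \<and> x = b)"
proof (cases "i = k")
  case True
  then show ?thesis using assms inj_at[of i x x'] by auto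
next
  case False
  consider "i = 1" "k = 2" | "i = 2" "k = 1" using False assms(1,4) by auto
  then show ?thesis
  proof cases
    case 1
    then have "d 1 x = c"
      using assms(6) range_1[OF assms(2)] range_2[OF assms(5)] by simp
    then have "x = a"
      using inj_at[of 1 x a] 1 assms(2,3) endpoints(3) c_bounds by simp
    with \<open>d 1 x = c\<close> 1 show ?thesis by blast
  next
    case 2
    then have "d 2 x = c"
      using assms(6) range_2[OF assms(2)] range_1[OF assms(5)] by simp
    then have "x = b"
      using inj_at[of 2 x b] 2 assms(2,3) endpoints(2) c_bounds by simp
    with \<open>d 2 x = c\<close> 2 show ?thesis by blast
  qed
qed

text \<open>Since \<open>d 2\<close> fixes \<open>a\<close> and \<open>a\<close> is not
  \<open>c\<close>, the exceptional case of \<open>same_image_cases\<close> is excluded.\<close>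

lemma step_to_a:
  assumes "proper_step x a"
  shows "x = a"
proof -
  obtain i where i: "i \<in> {1, 2}" "x \<in> {a..b}" "d' i x \<noteq> 0" "d i x = a"
    by (rule proper_stepE[OF assms])
  have "d i x = d 2 a" "d i x \<noteq> c"
    unfolding i(4) endpoints(1) using c_bounds by simp_all
  moreover have "2 \<in> {1, 2::nat}" "a \<in> {a..b}" using c_bounds by auto
  ultimately show ?thesis using same_image_cases[OF i(1-3)] by blast
qed

lemma step_to_b:
  assumes "proper_step x b"
  shows "x = b"
proof -
  obtain i where i: "i \<in> {1, 2}" "x \<in> {a..b}" "d' i x \<noteq> 0" "d i x = b"
    by (rule proper_stepE[OF assms])
  have "d i x = d 1 b" "d i x \<noteq> c"
    unfolding i(4) endpoints(4) using c_bounds by simp_all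
  moreover have "1 \<in> {1, 2::nat}" "b \<in> {a..b}" using c_bounds by auto
  ultimately show ?thesis using same_image_cases[OF i(1-3)] by blast
qed

text \<open>The exceptional pair consists of the two preimages of \<open>c\<close>: \<open>a\<close>
  under \<open>d 1\<close> and \<open>b\<close> under \<open>d 2\<close>.\<close>

lemma step_unique_source:
  assumes "proper_step x y" "proper_step x' y"
  shows "x = x' \<or> {x, x'} = {a, b}"
proof -
  obtain i where i: "i \<in> {1, 2}" "x \<in> {a..b}" "d' i x \<noteq> 0" "d i x = y"
    by (rule proper_stepE[OF assms(1)])
  obtain k where k: "k \<in> {1, 2}" "x' \<in> {a..b}" "d' k x' \<noteq> 0" "d k x' = y"
    by (rule proper_stepE[OF assms(2)])
  have eq: "d i x = d k x'" "d k x' = d i x" unfolding i(4) k(4) by (rule refl)+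
  have "x = x' \<or> x = a \<or> x = b" "x = x' \<or> x' = a \<or> x' = b"
    using same_image_cases[OF i(1-3) k(1,2) eq(1)] same_image_cases[OF k(1-3) i(1,2) eq(2)] by blast+
  then show ?thesis by blast
qed

text \<open>An ambiguity between \<open>a\<close> and \<open>b\<close> at a later position is
  carried back to the start, because each of them is entered only from itself.\<close>

lemma steps_unique_source:
  assumes "(proper_step ^^ n) x y" "(proper_step ^^ n) x' y"
  shows "x = x' \<or> {x, x'} = {a, b}"
  using assms
proof (induction n arbitrary: x x')
  case (Suc n)
  obtain z z' where z: "proper_step x z" "(proper_step ^^ n) z y"
    "proper_step x' z'" "(proper_step ^^ n) z' y"
    using Suc.prems by (blast dest: relpowp_Suc_D2)
  consider "z = z'" | "{z, z'} = {a, b}" using Suc.IH z by blast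
  then show ?case
  proof cases
    case 1
    then show ?thesis using z step_unique_source by blast
  next
    case 2
    then show ?thesis using z step_to_a step_to_b by (metis doubleton_eq_iff)
  qed
qed simp

text \<open>Going round the two cycles in either order gives two paths of equal length from \<open>t\<close> to
  \<open>t\<close> with different second points, although paths are determined by their ends up to the
  double predecessor of \<open>c\<close>.\<close>

lemma not_two_cycles:
  assumes t: "t \<in> {a..b}" "d' 1 t \<noteq> 0" "d' 2 t \<noteq> 0"
    and cycles: "proper_step\<^sup>*\<^sup>* (d 1 t) t" "proper_step\<^sup>*\<^sup>* (d 2 t) t"
  shows False
proof -
  obtain n m where nm: "(proper_step ^^ n) (d 1 t) t" "(proper_step ^^ m) (d 2 t) t"
    using cycles by (blast dest: rtranclp_imp_relpowp)
  have step: "proper_step t (d 1 t)" "proper_step t (d 2 t)"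
    using t by (auto intro: proper_stepI)
  have "(proper_step ^^ (n + Suc m)) (d 1 t) t" "(proper_step ^^ (m + Suc n)) (d 2 t) t"
    unfolding relpowp_add using nm step by (blast intro: relpowp_Suc_I2)+
  then have "d 1 t = d 2 t \<or> {d 1 t, d 2 t} = {a, b}"
    using steps_unique_source[of "Suc (n + m)" "d 1 t" t "d 2 t"] by (simp add: add.commute)
  then show False
  proof
    assume "d 1 t = d 2 t"
    \<comment> \<open>Properness of the step by \<open>d 1\<close> forces the common value to come
      from \<open>a\<close>, properness of the step by \<open>d 2\<close> forces it to come from
      \<open>b\<close>.\<close>
    then have "t = a" "t = b"
      using same_image_cases[OF _ t(1,2), of 2 t] same_image_cases[OF _ t(1,3), of 1 t] t(1)
      by simp_all
    then show False using c_bounds by simp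
  next
    assume "{d 1 t, d 2 t} = {a, b}"
    then show False using step step_to_a step_to_b c_bounds
      by (metis doubleton_eq_iff order.strict_trans order_less_irrefl)
  qed
qed

section \<open>Orbit closures\<close>

text \<open>The increments of both maps are nonnegative and, by \<open>sum_eq\<close>, add up to the
  increment of the argument.\<close>

lemma nonexpansive:
  assumes "i \<in> {1, 2}" "x \<in> {a..b}" "y \<in> {a..b}"
  shows "\<bar>d i x - d i y\<bar> \<le> \<bar>x - y\<bar>"
proof -
  have *: "\<bar>d i v - d i u\<bar> \<le> v - u" if "a \<le> u" "u \<le> v" "v \<le> b" for u v
    using that assms(1) mono[of 1 u v] mono[of 2 u v] sum_eq[of u] sum_eq[of v] by auto
  show ?thesis
    using *[of x y] *[of y x] assms by (cases "x \<le> y") (auto simp: abs_minus_commute)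
qed

lemma nonzero_near:
  assumes "i \<in> {1, 2}" "x \<in> {a..b}" "d' i x \<noteq> 0"
  obtains e where "0 < e" "\<And>y. y \<in> {a..b} \<Longrightarrow> \<bar>y - x\<bar> < e \<Longrightarrow> d' i y \<noteq> 0"
proof
  \<comment> \<open>Adding 1 keeps the denominator positive when \<open>B\<close> is 0.\<close>
  show pos: "0 < d' i x / (B + 1)"
    using B_nonneg deriv_nonneg[OF assms(1,2)] assms(3) by simp
  fix y assume y: "y \<in> {a..b}" "\<bar>y - x\<bar> < d' i x / (B + 1)"
  have "\<bar>d' i y - d' i x\<bar> \<le> B * \<bar>y - x\<bar>" by (rule lipschitz[OF assms(1) y(1) assms(2)])
  also have "\<dots> \<le> (B + 1) * \<bar>y - x\<bar>" by (intro mult_right_mono) auto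
  also have "\<dots> < d' i x"
    using y(2) B_nonneg by (simp add: pos_less_divide_eq mult.commute)
  finally show "d' i y \<noteq> 0" by auto
qed

abbreviation orbit_closure :: "real \<Rightarrow> real set" where
  "orbit_closure x \<equiv> closure {s. proper_step\<^sup>*\<^sup>* x s}"

lemma orbit_closure_subset: "x \<in> {a..b} \<Longrightarrow> orbit_closure x \<subseteq> {a..b}"
  by (intro closure_minimal) (auto dest: steps_in)

text \<open>Nonvanishing of \<open>d' i\<close> persists near \<open>y\<close>, so orbit points
  close to \<open>y\<close> may take the same step, and nonexpansiveness keeps their images close to
  \<open>z\<close>.\<close>

lemma orbit_closure_step:
  assumes "x \<in> {a..b}" "y \<in> orbit_closure x" "proper_step y z"
  shows "z \<in> orbit_closure x"
proof -
  obtain i where i: "i \<in> {1, 2}" "y \<in> {a..b}" "d' i y \<noteq> 0" "d i y = z"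
    by (rule proper_stepE[OF assms(3)])
  obtain e where e: "0 < e" "\<And>s. s \<in> {a..b} \<Longrightarrow> \<bar>s - y\<bar> < e \<Longrightarrow> d' i s \<noteq> 0"
    by (rule nonzero_near[OF i(1-3)]) blast
  show ?thesis unfolding closure_approachable
  proof (intro allI impI)
    fix r :: real assume "0 < r"
    then obtain s where s: "proper_step\<^sup>*\<^sup>* x s" "dist s y < min e r"
      using assms(2) e(1) unfolding closure_approachable by (metis mem_Collect_eq min_less_iff_conj)
    have sI: "s \<in> {a..b}" by (rule steps_in[OF s(1) assms(1)])
    have "proper_step s (d i s)"
      using proper_stepI[OF i(1) sI] e(2)[OF sI] s(2) by (simp add: dist_real_def)
    then have "proper_step\<^sup>*\<^sup>* x (d i s)" by (rule rtranclp.rtrancl_into_rtrancl[OF s(1)])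
    moreover have "dist (d i s) z < r"
      using nonexpansive[OF i(1) sI i(2)] s(2) unfolding i(4) dist_real_def by linarith
    ultimately show "\<exists>w\<in>{s. proper_step\<^sup>*\<^sup>* x s}. dist w z < r" by blast
  qed
qed

lemma orbit_closure_trans:
  assumes "x \<in> {a..b}" "y \<in> orbit_closure x"
  shows "orbit_closure y \<subseteq> orbit_closure x"
proof (intro closure_minimal subsetI)
  fix z assume "z \<in> {s. proper_step\<^sup>*\<^sup>* y s}"
  then have "proper_step\<^sup>*\<^sup>* y z" by simp
  then show "z \<in> orbit_closure x"
    by (induction rule: rtranclp_induct) (use assms orbit_closure_step in blast)+
qed simp

end

section \<open>Sets invariant under proper steps\<close>

text \<open>The model is the orbit closure of a weak attractor. There preimages arise as limits, so
  \<open>backward\<close> does not ask for the step from \<open>x\<close> to be proper.\<close>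

locale invariant_set = two_branches +
  fixes K :: "real set"
  assumes K_subset: "K \<subseteq> {a..b}"
    and forward: "\<And>i x. i \<in> {1, 2} \<Longrightarrow> x \<in> K \<Longrightarrow> d' i x \<noteq> 0 \<Longrightarrow> d i x \<in> K"
    and backward: "\<And>y. y \<in> K \<Longrightarrow> \<exists>i\<in>{1, 2}. \<exists>x\<in>K. y = d i x"
begin

text \<open>If \<open>y\<close> were in \<open>K\<close>, it would have a preimage in
  \<open>K\<close>; by \<open>same_image_cases\<close> that preimage is \<open>x\<close>, or
  \<open>x\<close> is an endpoint of the interval.\<close>

lemma complement_step:
  assumes "x \<in> {a<..<b} - K" "proper_step x y"
  shows "y \<in> {a<..<b} - K"
proof -
  obtain i where i: "i \<in> {1, 2}" "x \<in> {a..b}" "d' i x \<noteq> 0" "d i x = y"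
    by (rule proper_stepE[OF assms(2)])
  have "y \<in> {a..b}" using maps_to[OF i(1,2)] unfolding i(4) .
  moreover have "y \<noteq> a" "y \<noteq> b" using assms step_to_a step_to_b by auto
  moreover have "y \<notin> K"
  proof
    assume "y \<in> K"
    then obtain k x' where k: "k \<in> {1, 2}" "x' \<in> K" "y = d k x'" using backward by blast
    have "d i x = d k x'" using i(4) k(3) by (rule trans)
    then have "x = x' \<or> x = a \<or> x = b"
      using same_image_cases[OF i(1-3) k(1)] k(2) K_subset by blast
    then show False using assms(1) k(2) by auto
  qed
  ultimately show ?thesis by auto
qed

text \<open>An orbit starting in the interior outside \<open>K\<close> stays there by
  \<open>complement_step\<close>, yet it has to enter an interval contained in
  \<open>K\<close>.\<close>

lemma eq_if_interior_hit:
  assumes "closed K" "{u<..<v} \<subseteq> K" "\<And>x. x \<in> {a..b} \<Longrightarrow> \<exists>s\<in>{u<..<v}. proper_step\<^sup>*\<^sup>* x s"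
  shows "K = {a..b}"
proof -
  have "x \<in> K" if x: "x \<in> {a<..<b}" for x
  proof (rule ccontr)
    assume "x \<notin> K"
    obtain s where s: "s \<in> {u<..<v}" "proper_step\<^sup>*\<^sup>* x s"
      using assms(3)[of x] x by auto
    from s(2) have "s \<in> {a<..<b} - K"
      by (induction rule: rtranclp_induct) (use x \<open>x \<notin> K\<close> complement_step in blast)+
    then show False using s(1) assms(2) by blast
  qed
  then have "closure {a<..<b} \<subseteq> K" by (intro closure_minimal assms(1)) blast
  then show ?thesis using K_subset c_bounds by simp
qed

section \<open>The tree of gaps descending from a gap\<close>

definition intact :: "nat \<Rightarrow> real \<times> real \<Rightarrow> bool" where
  "intact i g \<longleftrightarrow> d' i (fst g) \<noteq> 0 \<and> d' i (snd g) \<noteq> 0"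

definition push :: "nat \<Rightarrow> real \<times> real \<Rightarrow> real \<times> real" where
  "push i g = (d i (fst g), d i (snd g))"

lemma gap_in: "g \<in> gaps K \<Longrightarrow> fst g \<in> {a..b}" "g \<in> gaps K \<Longrightarrow> snd g \<in> {a..b}"
  using gapsD(1,2) K_subset by blast+

text \<open>The image endpoints are in \<open>K\<close> by \<open>forward\<close> and distinct by
  injectivity. A point of \<open>K\<close> strictly between them has a preimage in \<open>K\<close>;
  the separation of the ranges by \<open>c\<close> makes it a preimage under the same map, and
  monotonicity puts it inside the original gap.\<close>

lemma push_gap:
  assumes i: "i \<in> {1, 2}" and g: "g \<in> gaps K" "intact i g"
  shows "push i g \<in> gaps K"
proof -
  obtain p q where pq: "g = (p, q)" by force
  have *: "p \<in> K" "q \<in> K" "p < q" "{p<..<q} \<inter> K = {}" "d' i p \<noteq> 0" "d' i q \<noteq> 0"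
    using gapsD[OF g(1)] g(2) by (auto simp: pq intact_def)
  have I: "p \<in> {a..b}" "q \<in> {a..b}" using * K_subset by auto
  have lt: "d i p < d i q"
    using mono[OF i, of p q] inj_at[OF i I *(5)] I *(3) by force
  have "y \<notin> K" if y: "d i p < y" "y < d i q" for y
  proof
    assume "y \<in> K"
    then obtain k x where k: "k \<in> {1, 2}" "x \<in> K" "y = d k x" using backward by blast
    have x: "x \<in> {a..b}" using k K_subset by blast
    have "k = i"
    proof (rule ccontr)
      assume "k \<noteq> i"
      then consider "i = 1" "k = 2" | "i = 2" "k = 1" using i k(1) by auto
      then show False
        using range_1[OF I(1)] range_2[OF I(2)] range_1[OF x] range_2[OF x] y k(3)
        by cases auto
    qed
    then have "p < x" "x < q"
      using mono[OF i, of x p] mono[OF i, of q x] y k(3) x I by force+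
    then show False using *(4) k(2) by auto
  qed
  then show ?thesis
    using lt forward[OF i *(1,5)] forward[OF i *(2,6)] by (auto simp: gaps_def push_def pq)
qed

text \<open>A nondegenerate interval cannot lie on both sides of \<open>c\<close>, which fixes the
  index; injectivity at the endpoints fixes the gap.\<close>

lemma push_inj:
  assumes i: "i \<in> {1, 2}" "g \<in> gaps K" "intact i g"
    and k: "k \<in> {1, 2}" "h \<in> gaps K" "intact k h" and eq: "push i g = push k h"
  shows "i = k" "g = h"
proof -
  have e: "d i (fst g) = d k (fst h)" "d i (snd g) = d k (snd h)"
    using eq by (auto simp: push_def)
  have lt: "d i (fst g) < d i (snd g)"
    using gapsD(3)[OF push_gap[OF i]] by (simp add: push_def)
  show "i = k"
  proof (rule ccontr)
    assume "i \<noteq> k"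
    then consider "i = 1" "k = 2" | "i = 2" "k = 1" using i(1) k(1) by auto
    then show False
      using range_1[OF gap_in(1)[OF i(2)]] range_2[OF gap_in(2)[OF i(2)]]
        range_1[OF gap_in(1)[OF k(2)]] range_2[OF gap_in(2)[OF k(2)]] e lt
      by cases auto
  qed
  then show "g = h"
    using inj_at[OF i(1) gap_in(1)[OF i(2)] gap_in(1)[OF k(2)]]
      inj_at[OF i(1) gap_in(2)[OF i(2)] gap_in(2)[OF k(2)]] i(3) e
    by (auto simp: intact_def prod_eq_iff)
qed

text \<open>Generation \<open>n\<close> of the tree below \<open>g\<close>: a branch ends where an
  endpoint lies in the guiding set of the map to be applied.\<close>

primrec level :: "real \<times> real \<Rightarrow> nat \<Rightarrow> (real \<times> real) set" where
  "level g 0 = {g}"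
| "level g (Suc n) = (\<lambda>(i, h). push i h) ` {(i, h). i \<in> {1, 2} \<and> h \<in> level g n \<and> intact i h}"

lemma level_SucE:
  assumes "h \<in> level g (Suc n)"
  obtains i k where "i \<in> {1, 2}" "k \<in> level g n" "intact i k" "push i k = h"
  using assms by auto

lemma level_subset_gaps: "g \<in> gaps K \<Longrightarrow> level g n \<subseteq> gaps K"
  by (induction n) (use push_gap in auto)

lemma finite_level: "finite (level g n)"
proof (induction n)
  case (Suc n)
  have "{(i, h). i \<in> {1, 2} \<and> h \<in> level g n \<and> intact i h} \<subseteq> {1, 2} \<times> level g n" by auto
  then have "finite {(i, h). i \<in> {1, 2} \<and> h \<in> level g n \<and> intact i h}"
    by (rule finite_subset) (use Suc in simp)
  then show ?case by simp
qed simp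

lemma len_push_le:
  assumes "i \<in> {1, 2}" "g \<in> gaps K"
  shows "len (push i g) \<le> len g"
  using nonexpansive[OF assms(1) gap_in(2,1)[OF assms(2)]] gapsD(3)[OF assms(2)]
  by (simp add: push_def)

lemma len_level_le:
  assumes "g \<in> gaps K"
  shows "h \<in> level g n \<Longrightarrow> len h \<le> len g"
proof (induction n arbitrary: h)
  case (Suc n)
  then obtain i k where k: "i \<in> {1, 2}" "k \<in> level g n" "h = push i k" by auto
  then show ?case
    using len_push_le[of i k] Suc.IH[of k] level_subset_gaps[OF assms, of n] by force
qed simp

lemma sum_len_push:
  assumes "g \<in> gaps K"
  shows "len (push 1 g) + len (push 2 g) = len g"
  using sum_eq[OF gap_in(1)[OF assms]] sum_eq[OF gap_in(2)[OF assms]] by (simp add: push_def)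

lemma len_push_not_intact:
  assumes "i \<in> {1, 2}" "g \<in> gaps K" "\<not> intact i g"
  shows "len (push i g) \<le> B * (len g)\<^sup>2"
  using quadratic[OF assms(1), of "fst g" "snd g"] gap_in[OF assms(2)] gapsD(3)[OF assms(2)]
    assms(3) by (auto simp: push_def intact_def)

text \<open>The two images of a gap \<open>h\<close> share its length exactly, and intact images of
  different gaps are different. Each of the at most two images that are dropped has length at most
  \<open>B * (len h)\<^sup>2\<close>, hence at most \<open>B * len g * len h\<close>.\<close>

lemma level_loss:
  assumes g: "g \<in> gaps K"
  shows "sum len (level g n) - 2 * B * len g * sum len (level g n) \<le> sum len (level g (Suc n))"
proof -
  let ?P = "{(i, h). i \<in> {1, 2} \<and> h \<in> level g n \<and> intact i h}"
  let ?f = "\<lambda>i h. if intact i h then len (push i h) else 0"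
  have gaps: "level g n \<subseteq> gaps K" by (rule level_subset_gaps[OF g])
  have "inj_on (\<lambda>(i, h). push i h) ?P"
  proof (rule inj_onI)
    fix x y assume xy: "x \<in> ?P" "y \<in> ?P" "(\<lambda>(i, h). push i h) x = (\<lambda>(i, h). push i h) y"
    obtain i h k h' where eq: "x = (i, h)" "y = (k, h')" by (cases x, cases y) blast
    have i: "i \<in> {1, 2}" "h \<in> gaps K" "intact i h" and k: "k \<in> {1, 2}" "h' \<in> gaps K" "intact k h'"
      using xy(1,2) gaps unfolding eq by blast+
    have "push i h = push k h'" using xy(3) by (simp add: eq)
    then show "x = y" using push_inj[OF i k] by (simp add: eq)
  qed
  then have "sum len (level g (Suc n)) = (\<Sum>(i, h)\<in>?P. len (push i h))"
    by (simp add: sum.reindex case_prod_unfold)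
  also have "\<dots> = (\<Sum>(i, h)\<in>{1, 2} \<times> level g n. ?f i h)"
    \<comment> \<open>Pairs that are not intact enter with value 0, so the sum runs over a full
      product and can be regrouped by gaps.\<close>
    by (rule sum.mono_neutral_cong_left) (use finite_level in \<open>auto split: if_splits\<close>)
  also have "\<dots> = (\<Sum>h\<in>level g n. ?f 1 h + ?f 2 h)"
    by (simp del: One_nat_def add: sum.cartesian_product[symmetric] sum.distrib)
  also have "\<dots> \<ge> (\<Sum>h\<in>level g n. len h - 2 * B * len g * len h)"
  proof (rule sum_mono)
    fix h assume h: "h \<in> level g n"
    then have hg: "h \<in> gaps K" using gaps by blast
    have "B * (len h)\<^sup>2 \<le> B * (len g * len h)"
      unfolding power2_eq_square using B_nonneg len_level_le[OF g h] gapsD(3)[OF hg]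
      by (intro mult_left_mono mult_right_mono) auto
    moreover have "0 \<le> B * (len h)\<^sup>2" using B_nonneg by simp
    ultimately have "len (push i h) - B * (len g * len h) \<le> ?f i h" if "i \<in> {1, 2}" for i
      using len_push_not_intact[OF that hg] by auto
    from this[of 1] this[of 2] show "len h - 2 * B * len g * len h \<le> ?f 1 h + ?f 2 h"
      using sum_len_push[OF hg] by (simp add: algebra_simps)
  qed
  finally show ?thesis by (simp only: sum_subtractf[where f = len] sum_distrib_left)
qed

text \<open>Nonzero derivatives at the left endpoint of \<open>g\<close> give both images positive
  length; as these lengths add up to \<open>len g\<close>, each is strictly smaller, and further
  pushes do not lengthen a gap.\<close>

lemma len_level_less:
  assumes g: "g \<in> gaps K" "d' 1 (fst g) \<noteq> 0" "d' 2 (fst g) \<noteq> 0"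
  shows "h \<in> level g (Suc n) \<Longrightarrow> len h < len g"
proof (induction n arbitrary: h)
  case 0
  have pos: "0 < len (push i g)" if i: "i \<in> {1, 2}" for i
  proof -
    have "d i (fst g) \<noteq> d i (snd g)"
      using inj_at[OF i gap_in[OF g(1)]] g(2,3) i gapsD(3)[OF g(1)] by auto
    then show ?thesis
      using mono[OF i, of "fst g" "snd g"] gap_in[OF g(1)] gapsD(3)[OF g(1)]
      by (simp add: push_def)
  qed
  obtain i where "i \<in> {1, 2}" "h = push i g" using 0 by auto
  then show ?case using pos[of 1] pos[of 2] sum_len_push[OF g(1)] by auto
next
  case (Suc n)
  obtain i k where k: "i \<in> {1, 2}" "k \<in> level g (Suc n)" "intact i k" "push i k = h"
    by (rule level_SucE[OF Suc.prems])
  have "k \<in> gaps K" using level_subset_gaps[OF g(1)] k(2) by blast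
  then have "len h \<le> len k" unfolding k(4)[symmetric] by (rule len_push_le[OF k(1)])
  also have "\<dots> < len g" by (rule Suc.IH[OF k(2)])
  finally show ?case .
qed

text \<open>A common gap is traced back by \<open>push_inj\<close> until \<open>g\<close> itself
  appears in a later level, which strict shortening forbids.\<close>

lemma disjoint_levels:
  assumes g: "g \<in> gaps K" "d' 1 (fst g) \<noteq> 0" "d' 2 (fst g) \<noteq> 0" and "n < m"
  shows "level g n \<inter> level g m = {}"
  using \<open>n < m\<close>
proof (induction n arbitrary: m)
  case 0
  then obtain k where k: "m = Suc k" by (cases m) auto
  have "g \<notin> level g (Suc k)" using len_level_less[OF g] by blast
  then show ?case unfolding k level.simps(1) by blast
next
  case (Suc n)
  then obtain k where k: "m = Suc k" "n < k" by (cases m) auto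
  then have IH: "level g n \<inter> level g k = {}" using Suc.IH by blast
  show ?case unfolding k(1)
  proof (rule ccontr)
    assume "level g (Suc n) \<inter> level g (Suc k) \<noteq> {}"
    then obtain y where y: "y \<in> level g (Suc n)" "y \<in> level g (Suc k)" by blast
    obtain i h where h: "i \<in> {1, 2}" "h \<in> level g n" "intact i h" "push i h = y"
      by (rule level_SucE[OF y(1)])
    obtain j h' where h': "j \<in> {1, 2}" "h' \<in> level g k" "intact j h'" "push j h' = y"
      by (rule level_SucE[OF y(2)])
    have "h \<in> gaps K" "h' \<in> gaps K" using level_subset_gaps[OF g(1)] h(2) h'(2) by blast+
    then have "h = h'"
      using push_inj(2)[OF h(1) _ h(3) h'(1) _ h'(3)] h(4) h'(4) by simp
    then show False using IH h(2) h'(2) by blast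
  qed
qed

text \<open>The derivatives at the left endpoint of the root are what makes the generations
  disjoint; descendants are controlled through their lengths alone.\<close>

lemma no_short_gaps:
  obtains \<epsilon> where "0 < \<epsilon>"
    "\<And>g. g \<in> gaps K \<Longrightarrow> len g < \<epsilon> \<Longrightarrow> d' 1 (fst g) = 0 \<or> d' 2 (fst g) = 0"
proof -
  \<comment> \<open>Chosen so that \<open>2 * B * \<eta> \<le> 1 / 2\<close>: the accumulated loss
    then never exceeds half of \<open>len g\<close>.\<close>
  define \<eta> where "\<eta> = 1 / (4 * (B + 1))"
  have "0 < \<eta>" using B_nonneg by (simp add: \<eta>_def)
  have "a \<le> b" using c_bounds by simp
  obtain \<epsilon> where \<epsilon>: "0 < \<epsilon>"
    "\<And>F. finite F \<Longrightarrow> F \<subseteq> gaps K \<Longrightarrow> (\<And>g. g \<in> F \<Longrightarrow> len g < \<epsilon>) \<Longrightarrow> sum len F \<le> \<eta>"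
    by (rule short_gaps_small_total[OF K_subset \<open>a \<le> b\<close> \<open>0 < \<eta>\<close>]) blast
  have False if g: "g \<in> gaps K" "len g < \<epsilon>" "d' 1 (fst g) \<noteq> 0" "d' 2 (fst g) \<noteq> 0" for g
  proof -
    define T where "T k = (\<Sum>n<k. sum len (level g n))" for k
    have T_le: "T k \<le> \<eta>" for k
    proof -
      have "T k = sum len (\<Union>n<k. level g n)"
        unfolding T_def
      proof (rule sum.UNION_disjoint[symmetric])
        show "\<forall>n\<in>{..<k}. \<forall>m\<in>{..<k}. n \<noteq> m \<longrightarrow> level g n \<inter> level g m = {}"
          using disjoint_levels[OF g(1,3,4)] by (metis Int_commute linorder_neqE_nat)
      qed (simp_all add: finite_level)
      also have "\<dots> \<le> \<eta>"
      proof (rule \<epsilon>(2))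
        show "(\<Union>n<k. level g n) \<subseteq> gaps K" using level_subset_gaps[OF g(1)] by blast
        show "len h < \<epsilon>" if "h \<in> (\<Union>n<k. level g n)" for h
          using that len_level_le[OF g(1)] g(2) by fastforce
      qed (simp add: finite_level)
      finally show ?thesis .
    qed
    have pos: "0 < len g" using gapsD(3)[OF g(1)] by simp
    \<comment> \<open>Each generation loses at most \<open>2 * B * len g\<close> times its own total
      length; these losses accumulate to a multiple of \<open>T k\<close>.\<close>
    have loss: "len g - 2 * B * len g * T k \<le> sum len (level g k)" for k
    proof (induction k)
      case (Suc k)
      then show ?case
        using level_loss[OF g(1), of k] by (simp add: T_def algebra_simps)
    qed (simp add: T_def)
    have half: "len g / 2 \<le> sum len (level g k)" for k
    proof -
      have "2 * B * len g * T k \<le> 2 * B * len g * \<eta>"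
        using T_le B_nonneg pos by (intro mult_left_mono) auto
      also have "\<dots> = len g * (B / (2 * (B + 1)))"
        using B_nonneg by (simp add: \<eta>_def field_simps)
      also have "\<dots> \<le> len g * (1 / 2)"
        using B_nonneg pos by (intro mult_left_mono) (auto simp: field_simps)
      finally show ?thesis using loss[of k] by simp
    qed
    \<comment> \<open>Each generation keeps at least half of \<open>len g\<close>, so sufficiently
      many of them together exceed \<eta>.\<close>
    obtain k :: nat where "\<eta> / (len g / 2) < real k" using reals_Archimedean2 by blast
    then have "\<eta> < real k * (len g / 2)" using pos by (simp add: pos_divide_less_eq)
    also have "\<dots> = (\<Sum>n<k. len g / 2)" by simp
    also have "\<dots> \<le> T k" unfolding T_def by (rule sum_mono) (rule half)
    finally show False using T_le[of k] by simp
  qed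
  then show thesis using that \<epsilon>(1) by blast
qed

end

section \<open>Weak attractors outside the guiding sets\<close>

context two_branches
begin

text \<open>For \<open>backward\<close>, every orbit point after the first is an image of an orbit
  point, so only \<open>t\<close> itself is in doubt; \<open>return\<close> exhibits it as a limit
  of images.\<close>

lemma invariant_set_orbit_closure:
  assumes t: "t \<in> {a..b}" "d' 1 t \<noteq> 0" and return: "t \<in> orbit_closure (d 1 t)"
  shows "invariant_set a b c B d d' (orbit_closure t)"
proof
  let ?K = "orbit_closure t"
  show subset: "?K \<subseteq> {a..b}" by (rule orbit_closure_subset[OF t(1)])
  show "d i x \<in> ?K" if "i \<in> {1, 2}" "x \<in> ?K" "d' i x \<noteq> 0" for i x
    by (rule orbit_closure_step[OF t(1) that(2) proper_stepI[OF that(1) _ that(3)]])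
      (use that(2) subset in blast)
  let ?F = "d 1 ` ?K \<union> d 2 ` ?K"
  have cont: "continuous_on ?K (d i)" if "i \<in> {1, 2}" for i
    using that subset deriv
    by (meson DERIV_continuous_on continuous_on_subset)
  have "compact ?K" using subset by (meson bounded_closed_interval bounded_subset closed_closure compact_eq_bounded_closed)
  then have "closed ?F"
    using cont by (intro compact_imp_closed compact_Un compact_continuous_image) auto
  have last: "s \<in> ?F" if "y \<in> ?K" "proper_step y s" for y s
    using that by (elim proper_stepE) auto
  \<comment> \<open>Once the starting point is an image, so are all points of its orbit, and the
    compact images keep this true in the closure.\<close>
  have reach: "orbit_closure x \<subseteq> ?F" if "x \<in> ?K" "x \<in> ?F" for x
  proof (intro closure_minimal subsetI \<open>closed ?F\<close>)
    fix s assume "s \<in> {s. proper_step\<^sup>*\<^sup>* x s}"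
    then have "proper_step\<^sup>*\<^sup>* x s" by simp
    then have "s \<in> ?K \<and> s \<in> ?F"
      by (induction rule: rtranclp_induct)
        (use that in simp, use last orbit_closure_step[OF t(1)] in blast)
    then show "s \<in> ?F" by blast
  qed
  have "t \<in> ?K" by (rule subsetD[OF closure_subset]) simp
  moreover have "d 1 t \<in> ?K"
    by (rule orbit_closure_step[OF t(1) calculation proper_stepI]) (use t in auto)
  \<comment> \<open>Applied first to \<open>d 1 t\<close>, \<open>reach\<close> shows that
    \<open>t\<close> is an image; it can then be applied to \<open>t\<close>.\<close>
  then have "t \<in> ?F" using reach[of "d 1 t"] return \<open>t \<in> ?K\<close> by blast
  ultimately have "?K \<subseteq> ?F" by (rule reach)
  then show "\<exists>i\<in>{1, 2}. \<exists>x\<in>?K. y = d i x" if "y \<in> ?K" for y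
    using that by blast
qed

lemma dense_orbits:
  assumes t: "t \<in> {a..b}" "d' 1 t \<noteq> 0" "d' 2 t \<noteq> 0"
    and attract: "\<And>x. x \<in> {a..b} \<Longrightarrow> t \<in> orbit_closure x"
    and x: "x \<in> {a..b}"
  shows "orbit_closure x = {a..b}"
proof -
  define K where "K = orbit_closure t"
  have images: "d 1 t \<in> {a..b}" "d 2 t \<in> {a..b}" using maps_to t(1) by blast+
  interpret invariant_set a b c B d d' K
    unfolding K_def using t attract[OF images(1)] by (intro invariant_set_orbit_closure)
  have "closed K" by (simp add: K_def)
  have "t \<in> K" using closure_subset by (force simp: K_def)
  have K_le: "K \<subseteq> orbit_closure y" if "y \<in> {a..b}" for y
    unfolding K_def by (rule orbit_closure_trans[OF that attract[OF that]])
  have not_isolated: "\<exists>y\<in>K. y \<noteq> t \<and> \<bar>y - t\<bar> < e" if "0 < e" for e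
  proof (rule ccontr)
    assume isolated: "\<not> ?thesis"
    \<comment> \<open>An orbit point close to an isolated \<open>t\<close> equals \<open>t\<close>,
      so both images return to \<open>t\<close> exactly.\<close>
    have "proper_step\<^sup>*\<^sup>* (d i t) t" if i: "i \<in> {1, 2}" for i
    proof -
      have "t \<in> orbit_closure (d i t)" using attract images i by blast
      then obtain s where s: "proper_step\<^sup>*\<^sup>* (d i t) s" "dist s t < e"
        using \<open>0 < e\<close> unfolding closure_approachable by blast
      have "proper_step t (d i t)" using proper_stepI[OF i t(1)] t i by auto
      then have "proper_step\<^sup>*\<^sup>* t s" using s(1) by (rule converse_rtranclp_into_rtranclp)
      then have "s \<in> K" unfolding K_def using closure_subset by blast
      then have "s = t" using isolated s(2) by (auto simp: dist_real_def)
      then show ?thesis using s(1) by simp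
    qed
    then show False using not_two_cycles[OF t] by blast
  qed
  obtain e1 where e1: "0 < e1" "\<And>y. y \<in> {a..b} \<Longrightarrow> \<bar>y - t\<bar> < e1 \<Longrightarrow> d' 1 y \<noteq> 0"
    using nonzero_near[of 1 t] t by auto
  obtain e2 where e2: "0 < e2" "\<And>y. y \<in> {a..b} \<Longrightarrow> \<bar>y - t\<bar> < e2 \<Longrightarrow> d' 2 y \<noteq> 0"
    using nonzero_near[of 2 t] t by auto
  obtain \<epsilon> where \<epsilon>: "0 < \<epsilon>"
    "\<And>g. g \<in> gaps K \<Longrightarrow> len g < \<epsilon> \<Longrightarrow> d' 1 (fst g) = 0 \<or> d' 2 (fst g) = 0"
    by (rule no_short_gaps) blast
  \<comment> \<open>The three bounds make every gap between \<open>y\<close> and \<open>t\<close>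
    shorter than \<epsilon>, with its left endpoint where neither derivative vanishes.\<close>
  obtain y where y: "y \<in> K" "y \<noteq> t" "\<bar>y - t\<bar> < min \<epsilon> (min e1 e2)"
    using not_isolated[of "min \<epsilon> (min e1 e2)"] \<epsilon>(1) e1(1) e2(1) by auto
  define l r where "l = min y t" and "r = max y t"
  have lr: "l < r" "l \<in> K" "r \<in> K" "t \<in> {l..r}" "r - l < min \<epsilon> (min e1 e2)"
    using y \<open>t \<in> K\<close> by (auto simp: l_def r_def min_def max_def)
  have "{l<..<r} \<subseteq> K"
  proof
    fix z assume z: "z \<in> {l<..<r}"
    show "z \<in> K"
    proof (rule ccontr)
      assume "z \<notin> K"
      \<comment> \<open>These are the points of \<open>K\<close> nearest to \<open>z\<close> on
        either side, the endpoints of the gap around \<open>z\<close>.\<close>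
      define p q where "p = Sup (K \<inter> {l..z})" and "q = Inf (K \<inter> {z..r})"
      have ne: "K \<inter> {l..z} \<noteq> {}" "K \<inter> {z..r} \<noteq> {}" using lr z by auto
      have bdd: "bdd_above (K \<inter> {l..z})" "bdd_below (K \<inter> {z..r})" by auto
      have "p \<in> K \<inter> {l..z}" "q \<in> K \<inter> {z..r}"
        unfolding p_def q_def
        by (rule closed_contains_Sup[OF ne(1) bdd(1)] closed_contains_Inf[OF ne(2) bdd(2)];
            use \<open>closed K\<close> in auto)+
      moreover from this have "p \<noteq> z" "q \<noteq> z" using \<open>z \<notin> K\<close> by auto
      ultimately have pq: "p \<in> K" "q \<in> K" "l \<le> p" "p < z" "z < q" "q \<le> r" by auto
      have "w \<notin> K" if w: "p < w" "w < q" for w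
      proof
        assume "w \<in> K"
        then consider "w \<in> K \<inter> {l..z}" | "w \<in> K \<inter> {z..r}" using w pq by force
        then show False
          using cSup_upper[OF _ bdd(1), of w] cInf_lower[OF _ bdd(2), of w] w
          by cases (auto simp: p_def q_def)
      qed
      then have "(p, q) \<in> gaps K" using pq by (auto simp: gaps_def)
      then have "d' 1 p = 0 \<or> d' 2 p = 0" using \<epsilon>(2)[of "(p, q)"] pq lr(5) by auto
      moreover have "p \<in> {a..b}" using pq(1) K_subset by blast
      moreover have "\<bar>p - t\<bar> < e1" "\<bar>p - t\<bar> < e2" using pq lr(4,5) by auto
      ultimately show False using e1(2) e2(2) by blast
    qed
  qed
  moreover have "\<exists>s\<in>{l<..<r}. proper_step\<^sup>*\<^sup>* y s" if y: "y \<in> {a..b}" for y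
  proof -
    \<comment> \<open>Since \<open>K\<close> lies in every orbit closure, the open interval meets
      the closure at its midpoint and therefore meets the orbit itself.\<close>
    have mid: "(l + r) / 2 \<in> {l<..<r}" using lr(1) by simp
    then have "(l + r) / 2 \<in> orbit_closure y" using calculation K_le[OF y] by blast
    moreover have "open {l<..<r}" by simp
    ultimately have "{l<..<r} \<inter> {s. proper_step\<^sup>*\<^sup>* y s} \<noteq> {}"
      using mid open_Int_closure_eq_empty by blast
    then show ?thesis by blast
  qed
  ultimately have "K = {a..b}" by (intro eq_if_interior_hit \<open>closed K\<close>)
  then show ?thesis using K_le[OF x] orbit_closure_subset[OF x] by blast
qed

text \<open>The mean slope of \<open>d 1\<close> is \<open>(b - c) / (b - a)\<close>, strictly
  between 0 and 1; where it is attained, both derivatives are nonzero.\<close>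

lemma ex_both_nonzero: "\<exists>t\<in>{a..b}. d' 1 t \<noteq> 0 \<and> d' 2 t \<noteq> 0"
proof -
  obtain z where z: "a < z" "z < b" "d 1 b - d 1 a = d' 1 z * (b - a)"
    using mean_value[of 1 a b] c_bounds by auto
  have "d' 1 z * (b - a) = b - c" using z(3) endpoints by simp
  then have "d' 1 z \<noteq> 0" "d' 1 z \<noteq> 1" using c_bounds by auto
  moreover have "d' 1 z + d' 2 z = 1" using deriv_sum[of z] z by simp
  ultimately show ?thesis using z by (intro bexI[of _ z]) auto
qed

end

section \<open>From the definitions to the locale\<close>

text \<open>The continuous second derivative is bounded on the compact interval, and the bound is a
  Lipschitz constant of the first derivative. In this form smoothness enters
  \<open>two_branches\<close>.\<close>

lemma C2_on_lipschitz_derivative: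
  assumes "C2_on {a..b} f"
  obtains f' M where "\<And>t. t \<in> {a..b} \<Longrightarrow> (f has_real_derivative f' t) (at t within {a..b})"
    "\<And>s t. s \<in> {a..b} \<Longrightarrow> t \<in> {a..b} \<Longrightarrow> \<bar>f' s - f' t\<bar> \<le> M * \<bar>s - t\<bar>"
proof -
  obtain f' f'' where f': "\<And>t. t \<in> {a..b} \<Longrightarrow> (f has_real_derivative f' t) (at t within {a..b})"
    and f'': "\<And>t. t \<in> {a..b} \<Longrightarrow> (f' has_real_derivative f'' t) (at t within {a..b})"
    and cont: "continuous_on {a..b} f''"
    using assms unfolding C2_on_def by blast
  have "bounded (f'' ` {a..b})"
    by (intro compact_imp_bounded compact_continuous_image cont compact_Icc)
  then obtain M where M: "\<And>t. t \<in> {a..b} \<Longrightarrow> norm (f'' t) \<le> M"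
    unfolding bounded_iff by blast
  have "\<bar>f' s - f' t\<bar> \<le> M * \<bar>s - t\<bar>" if "s \<in> {a..b}" "t \<in> {a..b}" for s t
    using field_differentiable_bound[OF _ f'' M that] by simp
  then show thesis using that f' by blast
qed

lemma (in two_branches) proper_orbit_Cons:
  assumes \<Lambda>: "\<And>i t. i \<in> {1, 2} \<Longrightarrow> t \<in> {a..b} \<Longrightarrow> t \<in> \<Lambda> i \<longleftrightarrow> d' i t = 0"
  shows "proper_orbit {a..b} d \<Lambda> (x # y # ys) \<longleftrightarrow>
    proper_step x y \<and> proper_orbit {a..b} d \<Lambda> (y # ys)"
proof -
  have *: "(\<forall>j. Suc j < length (x # y # ys) \<longrightarrow> P ((x # y # ys) ! j) ((x # y # ys) ! Suc j)) \<longleftrightarrow>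
    P x y \<and> (\<forall>j. Suc j < length (y # ys) \<longrightarrow> P ((y # ys) ! j) ((y # ys) ! Suc j))"
    for P :: "real \<Rightarrow> real \<Rightarrow> bool"
    by (auto simp: nth_Cons split: nat.splits)
  show ?thesis
    unfolding proper_orbit_def proper_step_def *[of "\<lambda>x y. \<exists>i\<in>{1, 2}. x \<notin> \<Lambda> i \<and> y = d i x"]
    using \<Lambda> maps_to by auto
qed

lemma (in two_branches) orbit_set_eq:
  assumes \<Lambda>: "\<And>i t. i \<in> {1, 2} \<Longrightarrow> t \<in> {a..b} \<Longrightarrow> t \<in> \<Lambda> i \<longleftrightarrow> d' i t = 0"
    and "t \<in> {a..b}"
  shows "orbit_set {a..b} d \<Lambda> t = {s. proper_step\<^sup>*\<^sup>* t s}"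
proof (intro subset_antisym subsetI)
  have Cons: "proper_orbit {a..b} d \<Lambda> (x # y # ys) \<longleftrightarrow>
    proper_step x y \<and> proper_orbit {a..b} d \<Lambda> (y # ys)" for x y ys
    by (rule proper_orbit_Cons) (rule \<Lambda>)
  have reach: "proper_step\<^sup>*\<^sup>* (hd ts) (last ts)" if "proper_orbit {a..b} d \<Lambda> ts" for ts
    using that
  proof (induction ts rule: induct_list012)
    case (3 x y ys)
    then show ?case
      unfolding Cons by (auto intro: converse_rtranclp_into_rtranclp)
  qed (simp_all add: proper_orbit_def)
  show "s \<in> {s. proper_step\<^sup>*\<^sup>* t s}" if "s \<in> orbit_set {a..b} d \<Lambda> t" for s
    using that reach unfolding orbit_set_def by blast
  fix s assume "s \<in> {s. proper_step\<^sup>*\<^sup>* t s}"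
  then have "proper_step\<^sup>*\<^sup>* t s" by simp
  then have "\<exists>ts. proper_orbit {a..b} d \<Lambda> (t # ts) \<and> last (t # ts) = s"
    using \<open>t \<in> {a..b}\<close>
  proof (induction rule: converse_rtranclp_induct)
    case base
    then show ?case by (intro exI[of _ "[]"]) (simp add: proper_orbit_def)
  next
    case (step x y)
    \<comment> \<open>Every term of a proper orbit has to lie in the interval, so membership is
      carried along the induction.\<close>
    have "y \<in> {a..b}" using step(1,4) by (blast intro: steps_in)
    then obtain ts where "proper_orbit {a..b} d \<Lambda> (y # ts)" "last (y # ts) = s"
      using step.IH by blast
    then show ?case
      using step(1) Cons by (intro exI[of _ "y # ts"]) simp
  qed
  then show "s \<in> orbit_set {a..b} d \<Lambda> t" unfolding orbit_set_def by force
qed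

theorem proposition2p3p4:
  fixes a b c :: real and \<delta> :: "nat \<Rightarrow> real \<Rightarrow> real" and \<Lambda> :: "nat \<Rightarrow> real set"
  assumes "P_configuration a b c \<delta>"
    and "\<Lambda> = guiding_set {a..b} \<delta>"
  shows "minimal_system {a..b} \<delta> \<Lambda> \<longleftrightarrow>
    (\<exists>t0 \<in> {a..b} - (\<Lambda> 1 \<union> \<Lambda> 2). weak_attractor {a..b} \<delta> \<Lambda> t0)"
proof -
  define d' where "d' i t = deriv_within {a..b} (\<delta> i) t" for i t
  have P: "a < c" "c < b" "\<delta> 2 a = a" "\<delta> 2 b = c" "\<delta> 1 a = c" "\<delta> 1 b = b"
    "\<And>i. i \<in> {1, 2} \<Longrightarrow> \<delta> i \<in> {a..b} \<rightarrow> {a..b}" "\<And>i. i \<in> {1, 2} \<Longrightarrow> C2_on {a..b} (\<delta> i)"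
    "\<And>t. t \<in> {a..b} \<Longrightarrow> d' 1 t + d' 2 t = 1"
    "\<And>i t. i \<in> {1, 2} \<Longrightarrow> t \<in> {a..b} \<Longrightarrow> 0 \<le> d' i t"
    using assms(1) unfolding P_configuration_def d'_def by auto
  have "\<exists>M. (\<forall>t\<in>{a..b}. (\<delta> i has_real_derivative d' i t) (at t within {a..b})) \<and>
    (\<forall>s\<in>{a..b}. \<forall>t\<in>{a..b}. \<bar>d' i s - d' i t\<bar> \<le> M * \<bar>s - t\<bar>)" if i: "i \<in> {1, 2}" for i
  proof -
    obtain f' M where f':
      "\<And>t. t \<in> {a..b} \<Longrightarrow> (\<delta> i has_real_derivative f' t) (at t within {a..b})"
      "\<And>s t. s \<in> {a..b} \<Longrightarrow> t \<in> {a..b} \<Longrightarrow> \<bar>f' s - f' t\<bar> \<le> M * \<bar>s - t\<bar>"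
      by (rule C2_on_lipschitz_derivative[OF P(8)[OF i]]) blast
    \<comment> \<open>Derivatives within a nondegenerate closed interval are unique, so
      \<open>d'\<close> is the derivative supplied by \<open>C2_on\<close>.\<close>
    have "d' i t = f' t" if "t \<in> {a..b}" for t
      unfolding d'_def using P(1,2) f'(1)[OF that] that
      by (intro vector_derivative_within_closed_interval)
        (auto simp: has_real_derivative_iff_has_vector_derivative)
    then show ?thesis using f' by (intro exI[of _ M]) simp
  qed
  then obtain M where M: "\<And>i t. i \<in> {1, 2} \<Longrightarrow> t \<in> {a..b} \<Longrightarrow>
      (\<delta> i has_real_derivative d' i t) (at t within {a..b})"
    "\<And>i s t. i \<in> {1, 2} \<Longrightarrow> s \<in> {a..b} \<Longrightarrow> t \<in> {a..b} \<Longrightarrow> \<bar>d' i s - d' i t\<bar> \<le> M i * \<bar>s - t\<bar>"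
    by metis
  interpret two_branches a b c "max (M 1) (M 2)" \<delta> d'
  proof
    fix i :: nat and s t assume *: "i \<in> {1, 2}" "s \<in> {a..b}" "t \<in> {a..b}"
    have "\<bar>d' i s - d' i t\<bar> \<le> M i * \<bar>s - t\<bar>" by (rule M(2)[OF *])
    also have "\<dots> \<le> max (M 1) (M 2) * \<bar>s - t\<bar>" using *(1) by (intro mult_right_mono) auto
    finally show "\<bar>d' i s - d' i t\<bar> \<le> max (M 1) (M 2) * \<bar>s - t\<bar>" .
  qed (use P M(1) in blast)+
  have \<Lambda>: "t \<in> \<Lambda> i \<longleftrightarrow> d' i t = 0" if "t \<in> {a..b}" for i t
    using that by (simp add: assms(2) guiding_set_def d'_def)
  have orbit: "closure (orbit_set {a..b} \<delta> \<Lambda> t) = orbit_closure t" if "t \<in> {a..b}" for t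
    using orbit_set_eq[of \<Lambda> t] \<Lambda> that by simp
  have good: "t \<in> {a..b} - (\<Lambda> 1 \<union> \<Lambda> 2) \<longleftrightarrow> t \<in> {a..b} \<and> d' 1 t \<noteq> 0 \<and> d' 2 t \<noteq> 0" for t
    using \<Lambda> by blast
  show ?thesis
  proof
    assume minimal: "minimal_system {a..b} \<delta> \<Lambda>"
    \<comment> \<open>Minimality makes every point a weak attractor, so any point outside both
      guiding sets will do.\<close>
    obtain t where "t \<in> {a..b}" "d' 1 t \<noteq> 0" "d' 2 t \<noteq> 0" using ex_both_nonzero by blast
    then show "\<exists>t0 \<in> {a..b} - (\<Lambda> 1 \<union> \<Lambda> 2). weak_attractor {a..b} \<delta> \<Lambda> t0"
      using minimal good unfolding minimal_system_def weak_attractor_def by blast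
  next
    assume "\<exists>t0 \<in> {a..b} - (\<Lambda> 1 \<union> \<Lambda> 2). weak_attractor {a..b} \<delta> \<Lambda> t0"
    then obtain t where t: "t \<in> {a..b}" "d' 1 t \<noteq> 0" "d' 2 t \<noteq> 0"
      and "weak_attractor {a..b} \<delta> \<Lambda> t" using good by blast
    then have "t \<in> orbit_closure x" if "x \<in> {a..b}" for x
      using orbit[OF that] that unfolding weak_attractor_def by blast
    then show "minimal_system {a..b} \<delta> \<Lambda>"
      unfolding minimal_system_def using orbit dense_orbits[OF t] by simp
  qed
qed

end
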